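(* Let $s$ be a positive integer. For every integer $k\ge 1$, $$\sum_{n=k}^\infty\left\{ {n \atop k} \right\}_s\frac{x^n}{n!}=\sum_{j=1}^k\frac{e^{j^s x}}{\prod_{i=0,\, i\ne j}^k(j^s-i^s)}+\frac{(-1)^k}{(k!)^s}.$$
   Context: For a positive integer $s$, the Stirling numbers of the second kind with level $s$, $\left\{ {n \atop k} \right\}_s$ ($n,k\ge 0$), are defined by the recurrence $\left\{ {n \atop k} \right\}_s=\left\{ {n-1 \atop k-1} \right\}_s+k^s\left\{ {n-1 \atop k} \right\}_s$ with $\left\{ {0 \atop 0} \right\}_s=1$ and $\left\{ {n \atop 0} \right\}_s=\left\{ {0 \atop n} \right\}_s=0$ for $n\ge 1$. The identity is an identity of power series in $x$. *)

theory Defs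
  imports "HOL-Computational_Algebra.Formal_Power_Series"
begin

fun level_stirling :: "nat \<Rightarrow> nat \<Rightarrow> nat \<Rightarrow> nat" where
  "level_stirling s 0 0 = 1"
| "level_stirling s 0 (Suc k) = 0"
| "level_stirling s (Suc n) 0 = 0"
| "level_stirling s (Suc n) (Suc k) =
     level_stirling s n k + Suc k ^ s * level_stirling s n (Suc k)"

end

theory Submission imports Defs begin

text \<open>
  With \<open>x j = j ^ s\<close>, the level-\<open>s\<close> Stirling number of \<open>n\<close> and \<open>k\<close> is the divided difference of
  the function \<open>z ^ n\<close> at the nodes \<open>x 0, ..., x k\<close>: writing
  \<open>x j ^ (n + 1) = x j ^ n * (x j - x k) + x k * x j ^ n\<close> shows that the divided differences obey
  the defining recurrence. Multiplying by \<open>X ^ n / n!\<close> and summing over \<open>n\<close> turns each power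
  \<open>x j ^ n\<close> into an exponential; the node \<open>x 0 = 0\<close> contributes the constant term.
\<close>

unbundle fps_syntax

text \<open>Lagrange's explicit form rather than the recursive one: it does not depend on an order
  of the nodes, and its denominators are those of the final formula.\<close>

definition power_divdiff :: "('i \<Rightarrow> 'a::field) \<Rightarrow> 'i set \<Rightarrow> nat \<Rightarrow> 'a" where
  "power_divdiff x A n = (\<Sum>j\<in>A. x j ^ n / (\<Prod>i\<in>A - {j}. x j - x i))"

text \<open>The factor \<open>x j - x a\<close> kills the term \<open>j = a\<close> and cancels
  against the denominator elsewhere. Any node may play the role of \<open>a\<close>.\<close>

lemma power_divdiff_Suc:
  fixes x :: "'i \<Rightarrow> 'a::field"
  assumes "finite A" "inj_on x A" "a \<in> A"
  shows "power_divdiff x A (Suc n) = power_divdiff x (A - {a}) n + x a * power_divdiff x A n"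
proof -
  define P where "P j = (\<Prod>i\<in>A - {j}. x j - x i)" for j
  have P: "P j = (x j - x a) * (\<Prod>i\<in>A - {a} - {j}. x j - x i)" if "j \<in> A - {a}" for j
  proof -
    have "A - {j} - {a} = A - {a} - {j}" by blast
    then show ?thesis
      unfolding P_def using that assms by (subst prod.remove[of _ a]) auto
  qed
  have "power_divdiff x A (Suc n) = (\<Sum>j\<in>A. x j ^ n * (x j - x a) / P j + x a * (x j ^ n / P j))"
    unfolding power_divdiff_def P_def[symmetric]
    by (intro sum.cong) (auto simp: algebra_simps simp flip: add_divide_distrib)
  also have "\<dots> = (\<Sum>j\<in>A. x j ^ n * (x j - x a) / P j) + x a * power_divdiff x A n"
    by (simp add: power_divdiff_def P_def sum.distrib sum_distrib_left)
  also have "(\<Sum>j\<in>A. x j ^ n * (x j - x a) / P j) = (\<Sum>j\<in>A - {a}. x j ^ n * (x j - x a) / P j)"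
    using assms by (simp add: sum.remove[of _ a])
  also have "\<dots> = power_divdiff x (A - {a}) n"
    unfolding power_divdiff_def
  proof (intro sum.cong refl)
    fix j assume j: "j \<in> A - {a}"
    then have "x j - x a \<noteq> 0" using assms by (auto dest: inj_onD)
    then show "x j ^ n * (x j - x a) / P j = x j ^ n / (\<Prod>i\<in>A - {a} - {j}. x j - x i)"
      by (simp add: P[OF j])
  qed
  finally show ?thesis .
qed

text \<open>Expanding \<open>power_divdiff x A 1\<close> by removing \<open>a\<close> or by removing
  \<open>b\<close> gives two expressions; by induction the smaller differences agree, so
  \<open>x a - x b\<close> times the value is 0.\<close>

lemma power_divdiff_0:
  fixes x :: "'i \<Rightarrow> 'a::field"
  assumes "finite A" "inj_on x A" "A \<noteq> {}"
  shows "power_divdiff x A 0 = (if card A = 1 then 1 else 0)"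
  using assms
proof (induction "card A" arbitrary: A rule: less_induct)
  case less
  show ?case
  proof (cases "card A = 1")
    case True
    then obtain a where "A = {a}" by (auto simp: card_1_singleton_iff)
    then show ?thesis by (simp add: power_divdiff_def)
  next
    case False
    obtain a where a: "a \<in> A" using less.prems by blast
    obtain b where b: "b \<in> A" "b \<noteq> a"
      using False a by (metis is_singletonI' is_singleton_altdef empty_iff)
    \<comment> \<open>The value does not depend on \<open>c\<close>; \<open>d\<close> only witnesses
      that a node remains.\<close>
    have removed: "power_divdiff x (A - {c}) 0 = (if card A = 2 then 1 else 0)"
      if "c \<in> A" "d \<in> A" "d \<noteq> c" for c d
    proof -
      have "card (A - {c}) = card A - 1" "card A > 0"
        using less.prems that by (auto simp: card_gt_0_iff)
      moreover have "A - {c} \<noteq> {}" using that by blast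
      moreover have "inj_on x (A - {c})" using less.prems by (auto intro: inj_on_subset)
      ultimately show ?thesis
        using less.hyps[of "A - {c}"] less.prems by auto
    qed
    have "(x a - x b) * power_divdiff x A 0
        = power_divdiff x (A - {b}) 0 - power_divdiff x (A - {a}) 0"
      using power_divdiff_Suc[of A x a 0] power_divdiff_Suc[of A x b 0] less.prems a b
      by (simp add: algebra_simps)
    also have "\<dots> = 0"
      using removed[of a b] removed[of b a] a b by simp
    finally show ?thesis
      using False a b less.prems by (auto dest: inj_onD)
  qed
qed

lemma level_stirling_eq_0: "n < k \<Longrightarrow> level_stirling s n k = 0"
  by (induction s n k rule: level_stirling.induct) auto

lemma level_stirling_eq_power_divdiff:
  assumes "s \<ge> 1"
  shows "(of_nat (level_stirling s n k) :: 'a::field_char_0)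
    = power_divdiff (\<lambda>j. of_nat j ^ s) {0..k} n"
  using assms
proof (induction s n k rule: level_stirling.induct)
  case (4 s n k)
  have "inj_on (\<lambda>j. of_nat j ^ s :: 'a) {0..Suc k}"
    using 4(3) by (auto simp: inj_on_def power_eq_iff_eq_base simp flip: of_nat_power)
  moreover have "{0..Suc k} - {Suc k} = {0..k}" by auto
  ultimately show ?case
    using 4 by (simp add: power_divdiff_Suc[of "{0..Suc k}" _ "Suc k"])
next
  \<comment> \<open>Row \<open>n = 0\<close>: the constant function 1 at two or more distinct
    nodes.\<close>
  case (2 s k)
  have "inj_on (\<lambda>j. of_nat j ^ s :: 'a) {0..Suc k}"
    using 2 by (auto simp: inj_on_def power_eq_iff_eq_base simp flip: of_nat_power)
  then show ?case by (simp add: power_divdiff_0)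
qed (auto simp: power_divdiff_def)

theorem theorem2:
  fixes s k :: nat
  assumes "s \<ge> 1" and "k \<ge> 1"
  shows "Abs_fps (\<lambda>n. if k \<le> n then of_nat (level_stirling s n k) / fact n else 0) =
    (\<Sum>j=1..k. fps_const (1 / (\<Prod>i\<in>{0..k} - {j}. of_nat j ^ s - of_nat i ^ s)) * fps_exp (of_nat j ^ s))
    + fps_const ((-1) ^ k / (fact k ^ s) :: 'a :: field_char_0)"
proof (rule fps_ext)
  fix n
  have split: "{0..k} = insert 0 {1..k}" and rest: "{0..k} - {0} = {1..k}" by auto
  have "(\<Prod>i\<in>{1..k}. - (of_nat i ^ s)) = (-1) ^ k * (fact k ^ s :: 'a)"
    by (simp add: fact_prod prod_power_distrib prod_uminus)
  then have const: "1 / (\<Prod>i\<in>{0..k} - {0}. 0 ^ s - of_nat i ^ s) = (-1) ^ k / (fact k ^ s :: 'a)"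
    \<comment> \<open>\<open>(-1) ^ k\<close> is its own inverse, so the sign moves to the
      numerator; hence the parity split.\<close>
    using assms unfolding rest by (cases "even k") (auto simp: power_0_left)
  have "Abs_fps (\<lambda>n. if k \<le> n then of_nat (level_stirling s n k) / fact n else 0 :: 'a) $ n
      = power_divdiff (\<lambda>j. of_nat j ^ s) {0..k} n / fact n"
    using assms level_stirling_eq_0[of n k s]
    by (simp flip: level_stirling_eq_power_divdiff)
  \<comment> \<open>Node 0 is split off: as \<open>s \<ge> 1\<close>, its power is
    \<open>0 ^ n\<close>, which is nonzero only in the constant coefficient.\<close>
  also have "\<dots> = (\<Sum>j=1..k. (of_nat j ^ s) ^ n / (\<Prod>i\<in>{0..k} - {j}. of_nat j ^ s - of_nat i ^ s)
      / fact n) + 0 ^ n * (1 / (\<Prod>i\<in>{0..k} - {0}. 0 ^ s - of_nat i ^ s)) / fact n"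
    using assms unfolding power_divdiff_def
    by (subst (1) split) (simp add: add_divide_distrib sum_divide_distrib power_0_left)
  finally show "Abs_fps (\<lambda>n. if k \<le> n then of_nat (level_stirling s n k) / fact n else 0) $ n =
    ((\<Sum>j=1..k. fps_const (1 / (\<Prod>i\<in>{0..k} - {j}. of_nat j ^ s - of_nat i ^ s)) * fps_exp (of_nat j ^ s))
    + fps_const ((-1) ^ k / (fact k ^ s) :: 'a :: field_char_0)) $ n"
    unfolding const by (simp add: fps_sum_nth power_0_left)
qed

end
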